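(* Let $N_0$ be a positive integer. Consider a quadratic equation of the form $$\mathcal{D}_{\log t}^4f\cdot f+\mathcal{D}_{\log t}^2f\cdot f-4\mathcal{D}^2_{\log t}(\delta f)\cdot f +\sum_{N=1}^{N_0} t^N \sum_{K=0}^{4} \sum_{I=0}^{\lfloor K/2 \rfloor}\alpha_{N,K,I}\,\delta^I f \cdot \delta^{K-I}f=0,$$ and consider its formal series solution of the form $$f(t)=t^{\sigma^2}\sum_{\substack{(m,n)\in (\mathbb{Z}_{\ge 0})^2 \\ \text{or } (m,n)\in \left( \frac{1}{2} +\mathbb{Z}_{\ge 0} \right)^2}} a_{m,n}\,t^{(2\sigma +1)m+(-2\sigma +1)n}.$$ When $\sigma \notin \mathbb{Q}$ and $\left| \mathrm{Re}\, \sigma \right| <\frac{1}{2}$, the formal series has a convergence domain in $\mathbb{C}\setminus\{ 0\}$ that contains a neighborhood of $0$.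
   Context: The $\alpha_{N,K,I}$ are constant coefficients and $\sigma$ is a complex parameter. $\delta=t\frac{d}{dt}$. The Hirota derivative with respect to $\delta$ is the bilinear operator $$\mathcal{D}^N_{\log t} f\cdot g:=\sum_{i=0}^N (-1)^i \binom{N}{i}\, \delta^{N-i}f \cdot \delta^i g .$$ Formal series are formal sums of monomials $c\,t^a$ with complex exponents, with $\delta t^a=a\,t^a$ applied termwise; a formal solution is one for which the coefficient of each power of $t$ vanishes after substitution. *)

theory Defs
  imports "HOL-Analysis.Analysis"
begin

text \<open>
  A formal series \<open>\<Sum> c\<^sub>a t\<^sup>a\<close> with complex exponents is represented by its coefficient
  function \<open>a \<mapsto> c\<^sub>a\<close>.
\<close>

type_synonym fseries = "complex \<Rightarrow> complex"

definition fs_delta :: "fseries \<Rightarrow> fseries" where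
  "fs_delta f = (\<lambda>a. a * f a)"

text \<open>
  The coefficient of \<open>t\<^sup>c\<close> in a product. The index set below is finite for the series considered
  here: for \<open>\<bar>Re \<sigma>\<bar> < 1/2\<close> a series \<open>fs_ansatz \<sigma> a\<close> has only finitely many exponents with real part
  below any given bound.
\<close>

definition fs_mult :: "fseries \<Rightarrow> fseries \<Rightarrow> fseries" where
  "fs_mult f g = (\<lambda>c. \<Sum>a | f a \<noteq> 0 \<and> g (c - a) \<noteq> 0. f a * g (c - a))"

text \<open>Multiplication by the monomial \<open>t\<^sup>N\<close>.\<close>

definition fs_shift :: "nat \<Rightarrow> fseries \<Rightarrow> fseries" where
  "fs_shift N f = (\<lambda>c. f (c - of_nat N))"

definition hirota :: "nat \<Rightarrow> fseries \<Rightarrow> fseries \<Rightarrow> fseries" where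
  "hirota N f g = (\<lambda>c. \<Sum>i=0..N. (-1) ^ i * of_nat (N choose i) *
      fs_mult ((fs_delta ^^ (N - i)) f) ((fs_delta ^^ i) g) c)"

definition quad_lhs :: "nat \<Rightarrow> (nat \<Rightarrow> nat \<Rightarrow> nat \<Rightarrow> complex) \<Rightarrow> fseries \<Rightarrow> fseries" where
  "quad_lhs N\<^sub>0 \<alpha> f = (\<lambda>c.
      hirota 4 f f c + hirota 2 f f c - 4 * hirota 2 (fs_delta f) f c
      + (\<Sum>N=1..N\<^sub>0. \<Sum>K=0..4. \<Sum>I=0..K div 2.
          \<alpha> N K I * fs_shift N (fs_mult ((fs_delta ^^ I) f) ((fs_delta ^^ (K - I)) f)) c))"

definition formal_solution :: "nat \<Rightarrow> (nat \<Rightarrow> nat \<Rightarrow> nat \<Rightarrow> complex) \<Rightarrow> fseries \<Rightarrow> bool" where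
  "formal_solution N\<^sub>0 \<alpha> f \<longleftrightarrow> (\<forall>c. quad_lhs N\<^sub>0 \<alpha> f c = 0)"

definition index_set :: "(real \<times> real) set" where
  "index_set = {(m, n). (m \<in> \<nat> \<and> n \<in> \<nat>) \<or> (m - 1/2 \<in> \<nat> \<and> n - 1/2 \<in> \<nat>)}"

definition expo :: "complex \<Rightarrow> real \<Rightarrow> real \<Rightarrow> complex" where
  "expo \<sigma> m n = (2 * \<sigma> + 1) * of_real m + (- 2 * \<sigma> + 1) * of_real n"

text \<open>
  The formal series \<open>t\<^bsup>\<sigma>\<^sup>2\<^esup> \<Sum> a\<^sub>m\<^sub>n t\<^bsup>expo \<sigma> m n\<^esup>\<close>, collecting terms with equal exponents.
  If \<open>\<sigma>\<close> is irrational, \<open>expo \<sigma>\<close> is injective on pairs and each sum has at most one term.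
\<close>

definition fs_ansatz :: "complex \<Rightarrow> (real \<Rightarrow> real \<Rightarrow> complex) \<Rightarrow> fseries" where
  "fs_ansatz \<sigma> a = (\<lambda>c. \<Sum>(m, n) | (m, n) \<in> index_set \<and> \<sigma>\<^sup>2 + expo \<sigma> m n = c. a m n)"

text \<open>
  The power \<open>t\<^sup>z\<close> for the determination of the argument of \<open>t\<close> in the interval
  \<open>(\<theta> - \<pi>, \<theta> + \<pi>]\<close>; for \<open>\<theta> = 0\<close> this is the principal value \<open>t powr z\<close>.
\<close>

definition branch_power :: "real \<Rightarrow> complex \<Rightarrow> complex \<Rightarrow> complex" where
  "branch_power \<theta> t z = exp (z * (Ln (t * cis (- \<theta>)) + \<i> * of_real \<theta>))"

text \<open>
  Convergence of the double series is unordered; for complex terms this is the same as absolute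
  convergence.
\<close>

definition ansatz_converges_at ::
    "complex \<Rightarrow> (real \<Rightarrow> real \<Rightarrow> complex) \<Rightarrow> real \<Rightarrow> complex \<Rightarrow> bool" where
  "ansatz_converges_at \<sigma> a \<theta> t \<longleftrightarrow>
     (\<lambda>(m, n). branch_power \<theta> t (\<sigma>\<^sup>2) * (a m n * branch_power \<theta> t (expo \<sigma> m n)))
       summable_on index_set"

end

theory Submission
  imports Defs
begin

text \<open>
  Let \<open>a\<^sub>0\<close> be the leading exponent of \<open>f\<close>. Comparing coefficients of \<open>t\<close> to the power \<open>a\<^sub>0 + x\<close>
  expresses \<open>f x\<close> through coefficients of lower grade, with the factor
  \<open>2 y\<^sup>2 (y\<^sup>2 - 2 y + 1 - 4 a\<^sub>0)\<close>, \<open>y = x - a\<^sub>0\<close>. As \<open>\<bar>Re \<sigma>\<bar> < 1/2\<close>, this grows like the fourth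
  power of the grade, which absorbs the at most four derivatives in every other term: there are no
  small divisors, and only finitely many resonances. Hence \<open>T\<^sub>n = \<Sum> \<bar>f x\<bar> z\<^bsup>gr x\<^esup>\<close> over
  \<open>1 \<le> gr x \<le> n\<close> satisfies \<open>T\<^sub>n\<^sub>+\<^sub>1 \<le> E z + C T\<^sub>n\<^sup>2 + C N\<^sub>0 z (\<bar>f a\<^sub>0\<bar> + T\<^sub>n)\<^sup>2\<close>, which stays below
  \<open>1 / (2 C)\<close> for small \<open>z\<close>.
\<close>

section \<open>Formal products and the symbols of the operators\<close>

lemma funpow_fs_delta: "(fs_delta ^^ i) f = (\<lambda>a. a ^ i * f a)"
  by (induction i) (auto simp: fs_delta_def)

text \<open>A common index set for the products of all derivatives of \<open>f\<close>: it depends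
  only on the support of \<open>f\<close>, so that the terms of the equation can be collected in one
  sum.\<close>

definition pairs :: "fseries \<Rightarrow> complex \<Rightarrow> complex set" where
  "pairs f c = {b. f b \<noteq> 0 \<and> f (c - b) \<noteq> 0}"

text \<open>The index set in \<open>fs_mult\<close> shrinks where \<open>b ^ i\<close> or
  \<open>(c - b) ^ j\<close> vanishes, but the lost terms are zero. Finiteness excludes the default
  value 0 of a sum over an infinite set.\<close>

lemma fs_mult_funpow_delta:
  assumes "finite (pairs f c)"
  shows "fs_mult ((fs_delta ^^ i) f) ((fs_delta ^^ j) f) c =
    (\<Sum>b\<in>pairs f c. f b * f (c - b) * (b ^ i * (c - b) ^ j))"
  unfolding fs_mult_def funpow_fs_delta
  by (rule sum.mono_neutral_cong_left) (use assms in \<open>auto simp: pairs_def\<close>)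

text \<open>The symbols by which the operators act on a product of monomials \<open>t\<^sup>a\<close>, \<open>t\<^sup>b\<close>.\<close>

definition symb :: "complex \<Rightarrow> complex \<Rightarrow> complex" where
  "symb a b = (a - b) ^ 4 + (a - b)\<^sup>2 - 4 * a * (a - b)\<^sup>2"

definition shift_symb ::
    "(nat \<Rightarrow> nat \<Rightarrow> nat \<Rightarrow> complex) \<Rightarrow> nat \<Rightarrow> complex \<Rightarrow> complex \<Rightarrow> complex" where
  "shift_symb \<alpha> N a b = (\<Sum>K=0..4. \<Sum>I=0..K div 2. \<alpha> N K I * (a ^ I * b ^ (K - I)))"

text \<open>By the binomial theorem, the Hirota derivative of order N multiplies a product of
  monomials with exponents a, b by (a - b)^N; the extra \<open>fs_delta\<close> on the first factor
  contributes a.\<close>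

lemma hirota_sum:
  assumes "finite (pairs f c)"
  shows "hirota 4 f f c + hirota 2 f f c - 4 * hirota 2 (fs_delta f) f c =
    (\<Sum>b\<in>pairs f c. f b * f (c - b) * symb b (c - b))"
proof -
  have mult: "fs_mult ((fs_delta ^^ i) (fs_delta f)) ((fs_delta ^^ j) f) c =
      (\<Sum>b\<in>pairs f c. f b * f (c - b) * (b ^ Suc i * (c - b) ^ j))" for i j
    using fs_mult_funpow_delta[OF assms, of "Suc i" j]
    by (simp add: funpow_swap1)
  show ?thesis
    unfolding hirota_def fs_mult_funpow_delta[OF assms] mult sum_distrib_left
      sum.swap[of _ "pairs f c"] sum.distrib[symmetric] sum_subtractf[symmetric]
  proof (intro sum.cong refl)
    fix b
    show "(\<Sum>i = 0..4. (- 1) ^ i * of_nat (4 choose i) *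
              (f b * f (c - b) * (b ^ (4 - i) * (c - b) ^ i))) +
          (\<Sum>i = 0..2. (- 1) ^ i * of_nat (2 choose i) *
              (f b * f (c - b) * (b ^ (2 - i) * (c - b) ^ i))) -
          (\<Sum>i = 0..2. 4 * ((- 1) ^ i * of_nat (2 choose i) *
              (f b * f (c - b) * (b ^ Suc (2 - i) * (c - b) ^ i)))) =
          f b * f (c - b) * symb b (c - b)"
      unfolding symb_def
      by (simp add: numeral_eq_Suc) (simp add: algebra_simps power_def numeral_eq_Suc)
  qed
qed

lemma shift_sum:
  assumes "finite (pairs f (c - of_nat N))"
  shows "(\<Sum>K=0..4. \<Sum>I=0..K div 2.
      \<alpha> N K I * fs_shift N (fs_mult ((fs_delta ^^ I) f) ((fs_delta ^^ (K - I)) f)) c) =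
    (\<Sum>b\<in>pairs f (c - of_nat N).
      f b * f (c - of_nat N - b) * shift_symb \<alpha> N b (c - of_nat N - b))"
  unfolding fs_shift_def fs_mult_funpow_delta[OF assms] shift_symb_def sum_distrib_left
    sum.swap[of _ "pairs f (c - of_nat N)"]
  by (intro sum.cong refl) (simp add: algebra_simps)

lemma norm_symb_le:
  assumes "norm a \<le> X" "norm b \<le> X" "X \<ge> 1"
  shows "norm (symb a b) \<le> 36 * X ^ 4"
proof -
  have ab: "norm (a - b) \<le> 2 * X"
    using norm_triangle_ineq4[of a b] assms by simp
  have "norm (symb a b) \<le> norm (a - b) ^ 4 + (norm (a - b))\<^sup>2 + 4 * norm a * (norm (a - b))\<^sup>2"
    unfolding symb_def
    by (rule order_trans[OF norm_triangle_ineq4] order_trans[OF add_right_mono[OF norm_triangle_ineq]])+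
      (simp add: norm_mult norm_power)
  also have "\<dots> \<le> (2 * X) ^ 4 + (2 * X)\<^sup>2 + 4 * X * (2 * X)\<^sup>2"
    by (intro add_mono mult_mono power_mono ab) (use assms in auto)
  also have "\<dots> = 16 * X ^ 4 + 4 * X ^ 2 + 16 * X ^ 3"
    by (simp add: power_mult_distrib power2_eq_square power3_eq_cube)
  also have "\<dots> \<le> 36 * X ^ 4"
    using power_increasing[of 2 4 X] power_increasing[of 3 4 X] assms by simp
  finally show ?thesis .
qed

text \<open>Every monomial has degree K at most 4, so that X \<ge> 1 allows the common power
  \<open>X ^ 4\<close>, the order that \<open>norm_symb_ge\<close> can absorb.\<close>

lemma norm_shift_symb_le:
  assumes "norm a \<le> X" "norm b \<le> X" "X \<ge> 1"
  shows "norm (shift_symb \<alpha> N a b) \<le> (\<Sum>K=0..4. \<Sum>I=0..K div 2. norm (\<alpha> N K I)) * X ^ 4"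
  unfolding shift_symb_def sum_distrib_right
proof (intro sum_norm_le order_trans[OF norm_sum sum_mono])
  fix K I :: nat assume K: "K \<in> {0..4}" and I: "I \<in> {0..K div 2}"
  have "norm a ^ I * norm b ^ (K - I) \<le> X ^ I * X ^ (K - I)"
    by (intro mult_mono power_mono) (use assms in auto)
  also have "\<dots> = X ^ K" using I by (simp flip: power_add)
  also have "\<dots> \<le> X ^ 4" using K assms by (intro power_increasing) auto
  finally show "norm (\<alpha> N K I * (a ^ I * b ^ (K - I))) \<le> norm (\<alpha> N K I) * X ^ 4"
    by (simp add: norm_mult norm_power mult_left_mono)
qed

text \<open>The sum factors through y = a - a0, and for y large against 1 + |a0| the square in the
  second factor dominates the linear part, leaving at least |y|^2 / 2.\<close>

lemma norm_symb_ge: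
  assumes "4 + 4 * norm a0 \<le> norm (a - a0) / 2"
  shows "norm (symb a0 a + symb a a0) \<ge> norm (a - a0) ^ 4"
proof -
  define y where "y = a - a0"
  have y: "norm y \<ge> 8 + 8 * norm a0" using assms by (simp add: y_def)
  have eq: "symb a0 a + symb a a0 = 2 * y\<^sup>2 * (y\<^sup>2 - (2 * y + 4 * a0 - 1))"
    unfolding symb_def y_def by (simp add: power_def numeral_eq_Suc algebra_simps)
  have "norm (2 * y + 4 * a0 - 1) \<le> norm (2 * y) + norm (4 * a0) + 1"
    using norm_triangle_ineq4[of "2 * y + 4 * a0" 1] norm_triangle_ineq[of "2 * y" "4 * a0"] by simp
  hence 1: "norm (2 * y + 4 * a0 - 1) \<le> 2 * norm y + 4 * norm a0 + 1" by (simp add: norm_mult)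
  \<comment> \<open>Half of this is 4 |y|: one 2 |y| is the linear term, the other exceeds the
    constant 4 |a0| + 1.\<close>
  have "norm y * norm y \<ge> 8 * norm y" using y norm_ge_zero[of a0] by (intro mult_right_mono) linarith+
  hence "(norm y)\<^sup>2 / 2 \<ge> 2 * norm y + 4 * norm a0 + 1"
    using y norm_ge_zero[of a0] unfolding power2_eq_square by linarith
  hence "(norm y)\<^sup>2 / 2 \<le> norm (y\<^sup>2 - (2 * y + 4 * a0 - 1))"
    using norm_triangle_ineq2[of "y\<^sup>2" "2 * y + 4 * a0 - 1"] 1 by (simp add: norm_power)
  hence "2 * (norm y)\<^sup>2 * ((norm y)\<^sup>2 / 2) \<le> norm (symb a0 a + symb a a0)"
    unfolding eq norm_mult norm_power by (intro mult_mono) auto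
  thus ?thesis by (simp add: y_def power2_eq_square power4_eq_xxxx mult.assoc)
qed

section \<open>Recursion and majorant estimate for graded series\<close>

text \<open>The map from (x, b) to the pair of factors (b, e + x - b) is injective with values in M
  \<times> M, and the weights are nonnegative.\<close>

lemma sum_convolution_le:
  fixes w :: "complex \<Rightarrow> real"
  assumes "finite A" "finite M" "\<And>x. x \<in> A \<Longrightarrow> finite (Q x)" "\<And>b. w b \<ge> 0"
    and "\<And>x b. x \<in> A \<Longrightarrow> b \<in> Q x \<Longrightarrow> b \<in> M \<and> e + x - b \<in> M"
  shows "(\<Sum>x\<in>A. \<Sum>b\<in>Q x. w b * w (e + x - b)) \<le> (\<Sum>b\<in>M. w b)\<^sup>2"
proof -
  let ?h = "\<lambda>(x, b). (b, e + x - b)"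
  have inj: "inj_on ?h (Sigma A Q)"
    by (auto simp: inj_on_def)
  have "(\<Sum>x\<in>A. \<Sum>b\<in>Q x. w b * w (e + x - b)) = (\<Sum>(x, b)\<in>Sigma A Q. w b * w (e + x - b))"
    using assms by (intro sum.Sigma) auto
  also have "\<dots> = (\<Sum>(b, b')\<in>?h ` Sigma A Q. w b * w b')"
    by (subst sum.reindex[OF inj]) (auto intro!: sum.cong)
  also have "\<dots> \<le> (\<Sum>(b, b')\<in>M \<times> M. w b * w b')"
    using assms by (intro sum_mono2) auto
  also have "\<dots> = (\<Sum>b\<in>M. w b)\<^sup>2"
    by (simp add: sum_product sum.cartesian_product power2_eq_square)
  finally show ?thesis .
qed

text \<open>The grade replaces complex exponents by natural numbers, counted from the leading
  exponent \<open>a0\<close>; \<open>k\<close> is the grade of t. The two norm bounds make the size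
  of an exponent comparable to its grade, up to constants.\<close>

locale graded_series =
  fixes f :: fseries and a0 :: complex and gr :: "complex \<Rightarrow> nat" and k :: nat and B c :: real
  assumes base: "f a0 \<noteq> 0" "gr a0 = 0"
    and gr_pos: "\<And>x. f x \<noteq> 0 \<Longrightarrow> x \<noteq> a0 \<Longrightarrow> gr x > 0"
    and gr_add: "\<And>x b b' N. f x \<noteq> 0 \<Longrightarrow> f b \<noteq> 0 \<Longrightarrow> f b' \<noteq> 0 \<Longrightarrow>
      a0 + x = b + b' + of_nat N \<Longrightarrow> gr x = gr b + gr b' + k * N"
    and k_pos: "k > 0"
    and finite_gr: "\<And>n. finite {x. f x \<noteq> 0 \<and> gr x \<le> n}"
    and norm_le: "\<And>x. f x \<noteq> 0 \<Longrightarrow> norm x \<le> B * (gr x + 1)"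
    and norm_ge: "\<And>x. f x \<noteq> 0 \<Longrightarrow> c * gr x \<le> norm (x - a0) + B"
    and const_pos: "B \<ge> 1" "c > 0"
begin

lemma pairs_gr:
  assumes "f x \<noteq> 0" "b \<in> pairs f (a0 + x - of_nat N)"
  shows "f b \<noteq> 0" "f (a0 + x - of_nat N - b) \<noteq> 0"
    "gr x = gr b + gr (a0 + x - of_nat N - b) + k * N"
  using assms gr_add[of x b "a0 + x - of_nat N - b" N] by (auto simp: pairs_def)

lemma finite_pairs:
  assumes "f x \<noteq> 0"
  shows "finite (pairs f (a0 + x - of_nat N))"
  by (rule finite_subset[OF _ finite_gr[of "gr x"]]) (use pairs_gr[OF assms] in fastforce)

definition conv :: "nat \<Rightarrow> complex \<Rightarrow> real" where
  "conv N x = (\<Sum>b\<in>pairs f (a0 + x - of_nat N). norm (f b) * norm (f (a0 + x - of_nat N - b)))"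

text \<open>The pairs with b = a0 and b = x are left out: they contain \<open>f x\<close> itself and
  form the linear part of the recursion.\<close>

definition conv0 :: "complex \<Rightarrow> real" where
  "conv0 x = (\<Sum>b\<in>pairs f (a0 + x) - {a0, x}. norm (f b) * norm (f (a0 + x - b)))"

lemma recursion_norm:
  assumes "formal_solution N0 \<alpha> f" "f x \<noteq> 0" "x \<noteq> a0"
    and A: "A \<ge> 36" "\<And>N. N \<in> {1..N0} \<Longrightarrow> (\<Sum>K=0..4. \<Sum>I=0..K div 2. norm (\<alpha> N K I)) \<le> A"
  shows "norm (f a0) * norm (f x) * norm (symb a0 x + symb x a0) \<le>
    A * (B * (gr x + 1)) ^ 4 * (conv0 x + (\<Sum>N=1..N0. conv N x))"
proof -
  define X where "X = B * (real (gr x) + 1)"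
  have X: "X \<ge> 1" using const_pos mult_mono[of 1 B 1 "real (gr x) + 1"] by (simp add: X_def)
  \<comment> \<open>Grades add up to at most \<open>gr x\<close>, so neither factor has a larger
    grade than x.\<close>
  have normX: "norm b \<le> X" "norm (a0 + x - of_nat N - b) \<le> X"
    if "b \<in> pairs f (a0 + x - of_nat N)" for b N
  proof -
    note p = pairs_gr[OF assms(2) that]
    have "B * (gr b + 1) \<le> X" "B * (gr (a0 + x - of_nat N - b) + 1) \<le> X"
      unfolding X_def using p(3) const_pos by (auto intro!: mult_left_mono)
    thus "norm b \<le> X" "norm (a0 + x - of_nat N - b) \<le> X"
      using norm_le[OF p(1)] norm_le[OF p(2)] by linarith+
  qed
  let ?P = "pairs f (a0 + x)"
  let ?s = "\<lambda>b. f b * f (a0 + x - b) * symb b (a0 + x - b)"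
  have fin: "finite ?P" using finite_pairs[OF assms(2), of 0] by simp
  have mem: "{a0, x} \<subseteq> ?P" using assms(2) base by (simp add: pairs_def)
  define W where "W = (\<Sum>b\<in>?P - {a0, x}. ?s b)"
  define V where "V N = (\<Sum>b\<in>pairs f (a0 + x - of_nat N).
      f b * f (a0 + x - of_nat N - b) * shift_symb \<alpha> N b (a0 + x - of_nat N - b))" for N
  \<comment> \<open>The equation at the exponent a0 + x is linear in \<open>f x\<close> apart from
    coefficients of lower grade, with b = a0 and b = x as its linear terms.\<close>
  have "0 = quad_lhs N0 \<alpha> f (a0 + x)"
    using assms(1) by (simp add: formal_solution_def)
  also have "\<dots> = (\<Sum>b\<in>?P. ?s b) + (\<Sum>N=1..N0. V N)"
    unfolding quad_lhs_def hirota_sum[OF fin] shift_sum[OF finite_pairs[OF assms(2)]] V_def ..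
  also have "(\<Sum>b\<in>?P. ?s b) = W + (\<Sum>b\<in>{a0, x}. ?s b)"
    unfolding W_def by (rule sum.subset_diff[OF mem fin])
  also have "(\<Sum>b\<in>{a0, x}. ?s b) = f a0 * f x * (symb a0 x + symb x a0)"
    using assms(3) by (simp add: algebra_simps)
  finally have "f a0 * f x * (symb a0 x + symb x a0) = - (W + (\<Sum>N=1..N0. V N))"
    by (simp add: eq_neg_iff_add_eq_0 algebra_simps)
  hence "norm (f a0) * norm (f x) * norm (symb a0 x + symb x a0) = norm (W + (\<Sum>N=1..N0. V N))"
    by (metis norm_minus_cancel norm_mult)
  also have "\<dots> \<le> norm W + (\<Sum>N=1..N0. norm (V N))"
    by (intro order_trans[OF norm_triangle_ineq] add_mono norm_sum order_refl)
  also have "norm W \<le> A * X ^ 4 * conv0 x"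
    unfolding W_def conv0_def sum_distrib_left
  proof (intro sum_norm_le)
    fix b assume b: "b \<in> ?P - {a0, x}"
    have "norm (symb b (a0 + x - b)) \<le> 36 * X ^ 4"
      using normX[of b 0] b X by (intro norm_symb_le) auto
    also have "\<dots> \<le> A * X ^ 4" using A X by (intro mult_right_mono) auto
    finally show "norm (?s b) \<le> A * X ^ 4 * (norm (f b) * norm (f (a0 + x - b)))"
      by (simp add: norm_mult mult.commute[of "A * X ^ 4"] mult_left_mono)
  qed
  also have "(\<Sum>N=1..N0. norm (V N)) \<le> (\<Sum>N=1..N0. A * X ^ 4 * conv N x)"
    unfolding V_def conv_def sum_distrib_left
  proof (intro sum_mono sum_norm_le)
    fix N b assume N: "N \<in> {1..N0}" and b: "b \<in> pairs f (a0 + x - of_nat N)"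
    have "norm (shift_symb \<alpha> N b (a0 + x - of_nat N - b)) \<le>
        (\<Sum>K=0..4. \<Sum>I=0..K div 2. norm (\<alpha> N K I)) * X ^ 4"
      using normX[OF b] X by (intro norm_shift_symb_le) auto
    also have "\<dots> \<le> A * X ^ 4" using A(2)[OF N] X by (intro mult_right_mono) auto
    finally show "norm (f b * f (a0 + x - of_nat N - b) * shift_symb \<alpha> N b (a0 + x - of_nat N - b))
        \<le> A * X ^ 4 * (norm (f b) * norm (f (a0 + x - of_nat N - b)))"
      by (simp add: norm_mult mult.commute[of "A * X ^ 4"] mult_left_mono)
  qed
  finally show ?thesis by (simp add: X_def distrib_left add.commute flip: sum_distrib_left)
qed

lemma conv_nonneg: "conv N x \<ge> 0" "conv0 x \<ge> 0"
  by (auto simp: conv_def conv0_def intro!: sum_nonneg)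

text \<open>For large grade, |x - a0| is at least a fixed multiple of \<open>gr x + 1\<close>, so
  the fourth powers in \<open>norm_symb_ge\<close> and \<open>recursion_norm\<close> cancel.
  Resonances, where the linear factor vanishes, can only lie below \<open>k0\<close>.\<close>

lemma recursion:
  assumes "formal_solution N0 \<alpha> f"
  obtains C k0 where "C \<ge> 1" "\<And>x. f x \<noteq> 0 \<Longrightarrow> gr x \<ge> k0 \<Longrightarrow>
    norm (f x) \<le> C * (conv0 x + (\<Sum>N=1..N0. conv N x))"
proof -
  define A where "A = 36 + (\<Sum>N=1..N0. \<Sum>K=0..4. \<Sum>I=0..K div 2. norm (\<alpha> N K I))"
  have A: "(\<Sum>K=0..4. \<Sum>I=0..K div 2. norm (\<alpha> N K I)) \<le> A" if "N \<in> {1..N0}" for N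
    unfolding A_def
    by (rule order_trans[OF member_le_sum[OF that,
          of "\<lambda>N. \<Sum>K=0..4. \<Sum>I=0..K div 2. norm (\<alpha> N K I)"]])
      (auto intro!: sum_nonneg)
  have A36: "A \<ge> 36" unfolding A_def by (auto intro!: sum_nonneg)
  define D where "D = norm (f a0) * (c / 4) ^ 4"
  have D: "D > 0" using base const_pos by (simp add: D_def)
  \<comment> \<open>In c * gr x \<ge> c + 2 B + 16 + 16 |a0|, the term 2 B absorbs the offset in
    \<open>norm_ge\<close>, the last two give the hypothesis of \<open>norm_symb_ge\<close>, and c
    gives gr x \<ge> 1, hence the factor c / 4 for \<open>gr x + 1\<close>.\<close>
  obtain k0 :: nat where k0: "real k0 \<ge> 1 + 2 * B / c + (16 + 16 * norm a0) / c"
    using real_arch_simple by blast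
  show ?thesis
  proof (rule that[of "1 + A * B ^ 4 / D" k0])
    show "1 + A * B ^ 4 / D \<ge> 1" using A36 D const_pos by simp
    fix x assume x: "f x \<noteq> 0" "gr x \<ge> k0"
    have "c * real (gr x) \<ge> c * (1 + 2 * B / c + (16 + 16 * norm a0) / c)"
      using x k0 const_pos by (intro mult_left_mono) auto
    also have "c * (1 + 2 * B / c + (16 + 16 * norm a0) / c) = c + 2 * B + 16 + 16 * norm a0"
      using const_pos by (simp add: field_simps)
    finally have cg: "c * real (gr x) \<ge> c + 2 * B + 16 + 16 * norm a0" .
    have y: "norm (x - a0) \<ge> c * real (gr x) / 2"
      using norm_ge[OF x(1)] cg const_pos norm_ge_zero[of a0] by linarith
    have "x \<noteq> a0"
    proof
      assume "x = a0"
      thus False using cg const_pos norm_ge_zero[of a0] base by simp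
    qed
    define S where "S = conv0 x + (\<Sum>N=1..N0. conv N x)"
    have S: "S \<ge> 0" by (auto simp: S_def intro!: add_nonneg_nonneg sum_nonneg conv_nonneg)
    define g where "g = real (gr x) + 1"
    have "c \<le> c * real (gr x)"
      using cg const_pos norm_ge_zero[of a0] by linarith
    hence "c / 4 * g \<le> norm (x - a0)"
      using y by (simp add: g_def algebra_simps)
    hence "(c / 4 * g) ^ 4 \<le> norm (x - a0) ^ 4"
      using const_pos by (intro power_mono) (auto simp: g_def)
    also have "\<dots> \<le> norm (symb a0 x + symb x a0)"
      using y cg const_pos by (intro norm_symb_ge) linarith
    finally have "norm (f a0) * norm (f x) * (c / 4 * g) ^ 4 \<le>
        norm (f a0) * norm (f x) * norm (symb a0 x + symb x a0)"
      by (intro mult_left_mono) auto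
    also have "\<dots> \<le> A * (B * g) ^ 4 * S"
      using recursion_norm[OF assms x(1) \<open>x \<noteq> a0\<close> A36 A] by (simp add: g_def S_def add.commute)
    finally have "g ^ 4 * (D * norm (f x)) \<le> g ^ 4 * (A * B ^ 4 * S)"
      by (simp only: D_def power_mult_distrib mult_ac)
    moreover have "g ^ 4 > 0" by (simp add: g_def)
    ultimately have "D * norm (f x) \<le> A * B ^ 4 * S" by (simp only: mult_le_cancel_left_pos)
    hence "norm (f x) \<le> A * B ^ 4 / D * S" using D by (simp add: field_simps)
    also have "\<dots> \<le> (1 + A * B ^ 4 / D) * S" using S by (intro mult_right_mono) auto
    finally show "norm (f x) \<le> (1 + A * B ^ 4 / D) * (conv0 x + (\<Sum>N=1..N0. conv N x))"
      by (simp add: S_def)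
  qed
qed

text \<open>Without \<open>a0\<close> all grades are positive, so every weight carries a factor z
  and \<open>supp_le 0\<close> is empty.\<close>

definition supp_le :: "nat \<Rightarrow> complex set" where
  "supp_le n = {x. f x \<noteq> 0 \<and> x \<noteq> a0 \<and> gr x \<le> n}"

lemma finite_supp_le: "finite (supp_le n)"
  by (rule finite_subset[OF _ finite_gr[of n]]) (auto simp: supp_le_def)

definition weight :: "real \<Rightarrow> complex \<Rightarrow> real" where
  "weight z x = norm (f x) * z ^ gr x"

lemma weight_nonneg: "z \<ge> 0 \<Longrightarrow> weight z x \<ge> 0"
  by (simp add: weight_def)

text \<open>Both factors have positive grade and the grades add up to \<open>gr x\<close>, so each
  is at most n; powers of z split accordingly.\<close>

lemma sum_conv0_le:
  assumes "z \<ge> 0"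
  shows "(\<Sum>x\<in>supp_le (Suc n). z ^ gr x * conv0 x) \<le> (\<Sum>x\<in>supp_le n. weight z x)\<^sup>2"
proof -
  let ?Q = "\<lambda>x. pairs f (a0 + x) - {a0, x}"
  have Q: "b \<in> supp_le n \<and> a0 + x - b \<in> supp_le n \<and>
      z ^ gr x * (norm (f b) * norm (f (a0 + x - b))) = weight z b * weight z (a0 + x - b)"
    if x: "x \<in> supp_le (Suc n)" and b: "b \<in> ?Q x" for x b
  proof -
    have "f x \<noteq> 0" using x by (simp add: supp_le_def)
    note p = pairs_gr[OF this, of b 0, simplified]
    have "gr b > 0" "gr (a0 + x - b) > 0"
      using p b by (auto intro!: gr_pos)
    thus ?thesis using p b x by (auto simp: supp_le_def weight_def power_add)
  qed
  have "(\<Sum>x\<in>supp_le (Suc n). z ^ gr x * conv0 x) = (\<Sum>x\<in>supp_le (Suc n). \<Sum>b\<in>?Q x. weight z b * weight z (a0 + x - b))"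
    unfolding conv0_def sum_distrib_left using Q by (intro sum.cong refl) blast
  also have "\<dots> \<le> (\<Sum>x\<in>supp_le n. weight z x)\<^sup>2"
  proof (rule sum_convolution_le)
    fix x assume "x \<in> supp_le (Suc n)"
    thus "finite (?Q x)" using finite_pairs[of x 0] by (simp add: supp_le_def)
  qed (use Q weight_nonneg assms finite_supp_le in blast)+
  finally show ?thesis .
qed

text \<open>Here a factor may be \<open>a0\<close>, but the shift takes k * N \<ge> 1 off the grade:
  the other factor still has grade at most n, and the excess power of z is at most z.\<close>

lemma sum_conv_le:
  assumes "0 \<le> z" "z \<le> 1" "N > 0"
  shows "(\<Sum>x\<in>supp_le (Suc n). z ^ gr x * conv N x) \<le> z * (norm (f a0) + (\<Sum>x\<in>supp_le n. weight z x))\<^sup>2"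
proof -
  let ?Q = "\<lambda>x. pairs f (a0 + x - of_nat N)"
  let ?e = "a0 - of_nat N"
  have Q: "b \<in> insert a0 (supp_le n) \<and> ?e + x - b \<in> insert a0 (supp_le n) \<and>
      z ^ gr x * (norm (f b) * norm (f (a0 + x - of_nat N - b))) \<le> z * (weight z b * weight z (?e + x - b))"
    if x: "x \<in> supp_le (Suc n)" and b: "b \<in> ?Q x" for x b
  proof -
    have "f x \<noteq> 0" using x by (simp add: supp_le_def)
    note p = pairs_gr[OF this b]
    have e: "?e + x - b = a0 + x - of_nat N - b" by simp
    have kN: "k * N \<ge> 1" using k_pos assms by (simp add: Suc_le_eq)
    have zk: "z ^ (k * N) \<le> z" using power_decreasing[OF kN, of z] assms by simp
    have "z ^ gr x * (norm (f b) * norm (f (a0 + x - of_nat N - b))) =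
        z ^ (k * N) * (weight z b * weight z (a0 + x - of_nat N - b))"
      by (simp add: p(3) weight_def power_add)
    also have "\<dots> \<le> z * (weight z b * weight z (a0 + x - of_nat N - b))"
      using zk weight_nonneg assms by (intro mult_right_mono mult_nonneg_nonneg) auto
    moreover have "gr b \<le> n" "gr (a0 + x - of_nat N - b) \<le> n"
      using p(3) kN x unfolding supp_le_def mem_Collect_eq by linarith+
    ultimately show ?thesis unfolding e using p by (auto simp: supp_le_def)
  qed
  have "(\<Sum>x\<in>supp_le (Suc n). z ^ gr x * conv N x) \<le>
      (\<Sum>x\<in>supp_le (Suc n). \<Sum>b\<in>?Q x. z * (weight z b * weight z (?e + x - b)))"
    unfolding conv_def sum_distrib_left using Q by (intro sum_mono) blast
  also have "\<dots> = z * (\<Sum>x\<in>supp_le (Suc n). \<Sum>b\<in>?Q x. weight z b * weight z (?e + x - b))"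
    by (simp add: sum_distrib_left)
  also have "\<dots> \<le> z * (\<Sum>x\<in>insert a0 (supp_le n). weight z x)\<^sup>2"
  proof (intro mult_left_mono sum_convolution_le)
    fix x assume "x \<in> supp_le (Suc n)"
    thus "finite (?Q x)" using finite_pairs[of x N] by (simp add: supp_le_def)
  qed (use Q weight_nonneg assms finite_supp_le in blast)+
  also have "(\<Sum>x\<in>insert a0 (supp_le n). weight z x) = norm (f a0) + (\<Sum>x\<in>supp_le n. weight z x)"
    by (subst sum.insert) (auto simp: finite_supp_le, auto simp: supp_le_def weight_def base)
  finally show ?thesis .
qed

theorem summable_weight:
  assumes "formal_solution N0 \<alpha> f"
  obtains z where "0 < z" "z \<le> 1" "weight z summable_on {x. f x \<noteq> 0}"
proof -
  obtain C k0 where C: "C \<ge> 1" and rec: "\<And>x. f x \<noteq> 0 \<Longrightarrow> gr x \<ge> k0 \<Longrightarrow>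
      norm (f x) \<le> C * (conv0 x + (\<Sum>N=1..N0. conv N x))"
    using recursion[OF assms] by metis
  define E where "E = (\<Sum>x\<in>supp_le k0. norm (f x))"
  \<comment> \<open>R solves C R^2 = R / 2: the quadratic term reproduces half of the bound
    R.\<close>
  define R where "R = 1 / (2 * C)"
  define H where "H = E + C * N0 * (norm (f a0) + R)\<^sup>2"
  have E: "E \<ge> 0" by (auto simp: E_def intro: sum_nonneg)
  have H: "H \<ge> 0" using E C by (auto simp: H_def)
  have R: "R > 0" "C * R\<^sup>2 = R / 2" using C by (auto simp: R_def power2_eq_square field_simps)
  \<comment> \<open>Everything else carries a factor z and adds up to z H, which this choice keeps
    within the other half. The summand 1 avoids a division by 0.\<close>
  define z where "z = min 1 (R / 2 / (H + 1))"
  have z: "0 < z" "z \<le> 1" using R H by (auto simp: z_def)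
  have "z * (H + 1) \<le> R / 2 / (H + 1) * (H + 1)"
    unfolding z_def using H by (intro mult_right_mono) auto
  also have "\<dots> = R / 2" using H by (intro nonzero_eq_divide_eq[THEN iffD1]) auto
  finally have "z * (H + 1) \<le> R / 2" .
  hence zH: "z * H \<le> R / 2" using z by (simp add: algebra_simps)
  have T: "(\<Sum>x\<in>supp_le n. weight z x) \<le> R" for n
  proof (induction n)
    case 0
    have "supp_le 0 = {}" using gr_pos by (force simp: supp_le_def)
    thus ?case using R by simp
  next
    case (Suc n)
    define T where "T = (\<Sum>x\<in>supp_le n. weight z x)"
    have T: "0 \<le> T" "T \<le> R"
      using Suc z weight_nonneg[of z] by (auto simp: T_def intro: sum_nonneg)
    have zx: "z ^ gr x \<le> z" if "x \<in> supp_le m" for x m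
      using that gr_pos[of x] power_decreasing[of 1 "gr x" z] z by (simp add: supp_le_def Suc_le_eq)
    \<comment> \<open>The recursion says nothing in low grades. These finitely many coefficients are
      bounded by themselves times z.\<close>
    have "weight z x \<le> (if x \<in> supp_le k0 then z * norm (f x) else 0) +
        C * (z ^ gr x * conv0 x + (\<Sum>N=1..N0. z ^ gr x * conv N x))" if x: "x \<in> supp_le (Suc n)" for x
    proof (cases "x \<in> supp_le k0")
      case True
      have "C * (z ^ gr x * conv0 x + (\<Sum>N=1..N0. z ^ gr x * conv N x)) \<ge> 0"
        using C z by (intro mult_nonneg_nonneg add_nonneg_nonneg sum_nonneg) (auto simp: conv_nonneg)
      moreover have "weight z x \<le> z * norm (f x)"
        using mult_left_mono[OF zx[OF x], of "norm (f x)"] by (simp add: weight_def mult.commute)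
      ultimately show ?thesis using True by simp
    next
      case False
      hence "norm (f x) \<le> C * (conv0 x + (\<Sum>N=1..N0. conv N x))"
        using x by (intro rec) (auto simp: supp_le_def)
      hence "norm (f x) * z ^ gr x \<le> C * (conv0 x + (\<Sum>N=1..N0. conv N x)) * z ^ gr x"
        using z by (intro mult_right_mono) auto
      thus ?thesis using False by (simp add: weight_def sum_distrib_left algebra_simps)
    qed
    hence "(\<Sum>x\<in>supp_le (Suc n). weight z x) \<le> (\<Sum>x\<in>supp_le (Suc n). (if x \<in> supp_le k0 then z * norm (f x) else 0) +
        C * (z ^ gr x * conv0 x + (\<Sum>N=1..N0. z ^ gr x * conv N x)))"
      by (rule sum_mono)
    also have "\<dots> = (\<Sum>x\<in>supp_le (Suc n). if x \<in> supp_le k0 then z * norm (f x) else 0) +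
        C * ((\<Sum>x\<in>supp_le (Suc n). z ^ gr x * conv0 x) + (\<Sum>N=1..N0. \<Sum>x\<in>supp_le (Suc n). z ^ gr x * conv N x))"
      by (simp add: sum.distrib sum_distrib_left distrib_left) (rule sum.swap)
    also have "(\<Sum>x\<in>supp_le (Suc n). if x \<in> supp_le k0 then z * norm (f x) else 0) \<le> z * E"
    proof -
      have "(\<Sum>x\<in>supp_le (Suc n). if x \<in> supp_le k0 then z * norm (f x) else 0) =
          (\<Sum>x\<in>supp_le (Suc n) \<inter> supp_le k0. z * norm (f x))"
        by (rule sum.inter_restrict[OF finite_supp_le, symmetric])
      also have "\<dots> \<le> (\<Sum>x\<in>supp_le k0. z * norm (f x))"
        using z by (intro sum_mono2) (auto simp: finite_supp_le)
      finally show ?thesis by (simp add: E_def sum_distrib_left)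
    qed
    also have "(\<Sum>x\<in>supp_le (Suc n). z ^ gr x * conv0 x) \<le> T\<^sup>2"
      unfolding T_def using z by (intro sum_conv0_le) auto
    also have "(\<Sum>N=1..N0. \<Sum>x\<in>supp_le (Suc n). z ^ gr x * conv N x) \<le>
        (\<Sum>N=1..N0. z * (norm (f a0) + T)\<^sup>2)"
      unfolding T_def using z by (intro sum_mono sum_conv_le) auto
    also have "T\<^sup>2 \<le> R\<^sup>2" using T by (intro power_mono)
    also have "(\<Sum>N=1..N0. z * (norm (f a0) + T)\<^sup>2) \<le> (\<Sum>N=1..N0. z * (norm (f a0) + R)\<^sup>2)"
      using T z by (intro sum_mono mult_left_mono power_mono) auto
    also have "z * E + C * (R\<^sup>2 + (\<Sum>N=1..N0. z * (norm (f a0) + R)\<^sup>2)) = R / 2 + z * H"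
      by (simp add: H_def algebra_simps R(2)[symmetric])
    also have "\<dots> \<le> R" using zH by simp
    finally show ?case using C by simp
  qed
  have "weight z summable_on {x. f x \<noteq> 0}"
  proof (rule nonneg_bounded_partial_sums_imp_summable_on)
    show "\<And>x. x \<in> {x. f x \<noteq> 0} \<Longrightarrow> 0 \<le> weight z x" using z weight_nonneg by simp
    have "sum (weight z) X \<le> norm (f a0) + R" if "finite X" "X \<subseteq> {x. f x \<noteq> 0}" for X
    proof -
      obtain n where n: "\<forall>x\<in>X. gr x \<le> n"
        using finite_nat_set_iff_bounded_le[of "gr ` X"] \<open>finite X\<close> by auto
      have "sum (weight z) X \<le> sum (weight z) (insert a0 (supp_le n))"
        using that n z weight_nonneg finite_supp_le by (intro sum_mono2) (auto simp: supp_le_def)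
      also have "\<dots> = norm (f a0) + sum (weight z) (supp_le n)"
        by (subst sum.insert) (auto simp: finite_supp_le, auto simp: supp_le_def weight_def base)
      finally show ?thesis using T[of n] by simp
    qed
    thus "\<forall>\<^sub>F X in finite_subsets_at_top {x. f x \<noteq> 0}. sum (weight z) X \<le> norm (f a0) + R"
      by (intro eventually_finite_subsets_at_top_weakI)
  qed
  thus thesis using that z by blast
qed

end

section \<open>The lattice of exponents\<close>

lemma expo_eq: "expo \<sigma> m n = of_real (m + n) + 2 * \<sigma> * of_real (m - n)"
  by (simp add: expo_def algebra_simps)

text \<open>Sum and difference of two integers, or of two half-integers, are integers; these are the
  lattice coordinates used from here on.\<close>

lemma index_set_ints:
  assumes "(m, n) \<in> index_set"
  obtains p d :: int where "m + n = of_int p" "m - n = of_int d" "\<bar>d\<bar> \<le> p"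
proof -
  from assms consider (int) i j :: nat where "m = i" "n = j"
    | (half) i j :: nat where "m = i + 1 / 2" "n = j + 1 / 2"
    by (auto simp: index_set_def Nats_def algebra_simps)
  thus thesis
  proof cases
    case int thus thesis by (intro that[of "int i + int j" "int i - int j"]) auto
  next
    case half thus thesis by (intro that[of "int i + int j + 1" "int i - int j"]) auto
  qed
qed

text \<open>If d and d' differed, the equation could be solved for \<sigma> as a quotient of
  integers.\<close>

lemma irrational_lattice_inj:
  assumes "\<sigma> \<notin> \<rat>"
    and "of_int p + 2 * \<sigma> * of_int d = of_int p' + 2 * \<sigma> * (of_int d' :: complex)"
  shows "p = p' \<and> d = d'"
proof -
  have *: "2 * \<sigma> * of_int (d - d') = of_int (p' - p)" using assms(2) by (simp add: algebra_simps)
  have "d = d'"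
  proof (rule ccontr)
    assume "d \<noteq> d'"
    hence "\<sigma> = of_int (p' - p) / of_int (2 * (d - d'))"
      using * by (simp add: field_simps)
    thus False using assms(1) by (metis Rats_divide Rats_of_int)
  qed
  thus ?thesis using * by simp
qed

lemma expo_inj:
  assumes "\<sigma> \<notin> \<rat>" "(m, n) \<in> index_set" "(m', n') \<in> index_set" "expo \<sigma> m n = expo \<sigma> m' n'"
  shows "m = m' \<and> n = n'"
proof -
  obtain p d where 1: "m + n = of_int p" "m - n = of_int d"
    using index_set_ints[OF assms(2)] by metis
  obtain p' d' where 2: "m' + n' = of_int p'" "m' - n' = of_int d'"
    using index_set_ints[OF assms(3)] by metis
  have "p = p' \<and> d = d'"
    using assms(4) unfolding expo_eq 1 2
    by (intro irrational_lattice_inj[OF assms(1)]) simp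
  hence "m + n = m' + n'" "m - n = m' - n'" using 1 2 by auto
  thus ?thesis by auto
qed

lemma fs_ansatz_expo:
  assumes "\<sigma> \<notin> \<rat>" "(m, n) \<in> index_set"
  shows "fs_ansatz \<sigma> a (\<sigma>\<^sup>2 + expo \<sigma> m n) = a m n"
proof -
  have "{(m', n'). (m', n') \<in> index_set \<and> \<sigma>\<^sup>2 + expo \<sigma> m' n' = \<sigma>\<^sup>2 + expo \<sigma> m n} = {(m, n)}"
    using assms expo_inj[OF assms(1)] by auto
  thus ?thesis by (simp add: fs_ansatz_def)
qed

lemma fs_ansatz_support:
  assumes "fs_ansatz \<sigma> a x \<noteq> 0"
  obtains p d :: int where "x = \<sigma>\<^sup>2 + (of_int p + 2 * \<sigma> * of_int d)" "\<bar>d\<bar> \<le> p"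
proof -
  have "\<exists>m n. (m, n) \<in> index_set \<and> \<sigma>\<^sup>2 + expo \<sigma> m n = x"
  proof (rule ccontr)
    assume "\<not> ?thesis"
    hence "{(m, n). (m, n) \<in> index_set \<and> \<sigma>\<^sup>2 + expo \<sigma> m n = x} = {}" by auto
    thus False using assms unfolding fs_ansatz_def by (metis (no_types, lifting) sum.empty)
  qed
  then obtain m n where mn: "(m, n) \<in> index_set" "\<sigma>\<^sup>2 + expo \<sigma> m n = x" by blast
  obtain p d where pd: "m + n = of_int p" "m - n = of_int d" "\<bar>d\<bar> \<le> p"
    using index_set_ints[OF mn(1)] by metis
  thus thesis using that[of p d] mn(2) by (simp add: expo_eq)
qed

text \<open>
  No assumption is made on which coefficient of the series is the leading one. The grade is
  \<open>k (p - p\<^sub>0) + (d - d\<^sub>0)\<close> where \<open>(p\<^sub>0, d\<^sub>0)\<close> is the lexicographically smallest element of the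
  support; as \<open>\<bar>d\<bar> \<le> p\<close>, the choice \<open>k = 2 p\<^sub>0 + 2\<close> makes it positive at all other elements.
\<close>

lemma graded_summable:
  assumes sol: "formal_solution N0 \<alpha> f" and \<sigma>: "\<sigma> \<notin> \<rat>" "\<bar>Re \<sigma>\<bar> < 1/2"
    and supp: "\<And>x. f x \<noteq> 0 \<Longrightarrow> x = \<sigma>\<^sup>2 + (of_int (P x) + 2 * \<sigma> * of_int (D x)) \<and> \<bar>D x\<bar> \<le> P x"
  shows "\<exists>z>0. z \<le> 1 \<and> (\<lambda>x. norm (f x) * z powr of_int (P x)) summable_on {x. f x \<noteq> 0}"
proof (cases "\<exists>x. f x \<noteq> 0")
  case False
  hence "{x. f x \<noteq> 0} = {}" by simp
  thus ?thesis by (intro exI[of _ 1]) (simp del: Collect_empty_eq)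
next
  case True
  obtain x1 where x1: "f x1 \<noteq> 0" "\<And>x. f x \<noteq> 0 \<Longrightarrow> nat (P x1) \<le> nat (P x)"
    using True ex_has_least_nat[of "\<lambda>x. f x \<noteq> 0" _ "\<lambda>x. nat (P x)"] by blast
  \<comment> \<open>Second stage of the lexicographic minimum. On the slice P x = P x1 the value D x
    is at least -P x1, so after adding P x1 the conversion by \<open>nat\<close> loses
    nothing.\<close>
  obtain a0 where a0: "f a0 \<noteq> 0 \<and> P a0 = P x1"
    and a0_min: "\<And>x. f x \<noteq> 0 \<and> P x = P x1 \<Longrightarrow> nat (D a0 + P x1) \<le> nat (D x + P x1)"
    using x1(1) ex_has_least_nat[of "\<lambda>x. f x \<noteq> 0 \<and> P x = P x1" x1 "\<lambda>x. nat (D x + P x1)"] by blast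
  define p0 d0 where "p0 = P a0" and "d0 = D a0"
  have p0: "\<bar>d0\<bar> \<le> p0" using supp[of a0] a0 by (simp add: p0_def d0_def)
  have P_ge: "P x \<ge> p0" if "f x \<noteq> 0" for x
    using x1(2)[OF that] supp[OF that] supp[of a0] a0 by (auto simp: p0_def)
  have D_ge: "D x \<ge> d0" if "f x \<noteq> 0" "P x = p0" for x
    using a0_min[of x] supp[of x] that a0 p0 by (auto simp: p0_def d0_def)
  define k where "k = nat (2 * p0 + 2)"
  have k: "int k = 2 * p0 + 2" using p0 by (simp add: k_def)
  define g where "g x = int k * (P x - p0) + (D x - d0)" for x
  define gr where "gr x = nat (g x)" for x
  have PD_inj: "x = y" if "f x \<noteq> 0" "f y \<noteq> 0" "P x = P y" "D x = D y" for x y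
    using supp that by metis
  have g_ge: "g x \<ge> P x - 3 * p0" if "f x \<noteq> 0" for x
  proof -
    have "int k * (P x - p0) \<ge> 2 * (P x - p0)"
      unfolding k using P_ge[OF that] p0 by (intro mult_right_mono) auto
    thus ?thesis using supp[OF that] p0 unfolding g_def by auto
  qed
  have g_pos: "g x > 0" if "f x \<noteq> 0" "x \<noteq> a0" for x
  proof (cases "P x = p0")
    case True
    have "D x \<noteq> d0" using PD_inj[of x a0] that a0 True by (auto simp: p0_def d0_def)
    thus ?thesis using D_ge[OF that(1) True] by (simp add: g_def True)
  next
    case False
    \<comment> \<open>With D x - d0 \<ge> -(P x - p0) - 2 p0, the part 2 p0 (P x - p0) of the grade
      pays for 2 p0, and 2 (P x - p0) leaves a positive rest.\<close>
    hence y: "P x - p0 \<ge> 1" using P_ge[OF that(1)] by simp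
    hence "p0 * 1 \<le> p0 * (P x - p0)" using p0 by (intro mult_left_mono) auto
    moreover have "int k * (P x - p0) = 2 * (p0 * (P x - p0)) + 2 * (P x - p0)"
      unfolding k by (simp add: algebra_simps)
    moreover have "0 < u + (D x - d0)" if "p0 * 1 \<le> v" "u = 2 * v + 2 * (P x - p0)" for u v
      using that conjunct2[OF supp[OF \<open>f x \<noteq> 0\<close>]] p0 y by simp
    ultimately show ?thesis unfolding g_def by blast
  qed
  have g0: "g a0 = 0" by (simp add: g_def p0_def d0_def)
  have gr_int: "int (gr x) = g x" if "f x \<noteq> 0" for x
    using g_pos[OF that] g0 by (cases "x = a0") (auto simp: gr_def)
  have gr_real: "real (gr x) = of_int (g x)" if "f x \<noteq> 0" for x
    using gr_int[OF that] by (metis of_int_of_nat_eq)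
  have g_le: "g x \<le> int (k + 1) * P x" if "f x \<noteq> 0" for x
  proof -
    have "int k * p0 \<ge> 1 * p0" using k p0 by (intro mult_right_mono) auto
    thus ?thesis using supp[OF that] p0 unfolding g_def by (auto simp: algebra_simps)
  qed
  define \<epsilon> where "\<epsilon> = 1 - 2 * \<bar>Re \<sigma>\<bar>"
  have \<epsilon>: "\<epsilon> > 0" using \<sigma> by (simp add: \<epsilon>_def)
  \<comment> \<open>The first two terms bound |x| by the grade, 1 ensures B \<ge> 1, and 2 p0 is the
    offset in the bound of |x - a0| from below.\<close>
  define B where "B = (norm \<sigma>)\<^sup>2 + (1 + 2 * norm \<sigma>) * (1 + 3 * of_int p0) + 1 + 2 * of_int p0"
  have B0: "(norm \<sigma>)\<^sup>2 + (1 + 2 * norm \<sigma>) * (1 + 3 * of_int p0) \<ge> 0"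
    using p0 by (intro add_nonneg_nonneg mult_nonneg_nonneg) auto
  have "graded_series f a0 gr k B (\<epsilon> / real (k + 1))"
  proof
    show "f a0 \<noteq> 0" "gr a0 = 0" using a0 g0 by (auto simp: gr_def)
    show "gr x > 0" if "f x \<noteq> 0" "x \<noteq> a0" for x using g_pos[OF that] by (simp add: gr_def)
    show "gr x = gr b + gr b' + k * N"
      if nz: "f x \<noteq> 0" "f b \<noteq> 0" "f b' \<noteq> 0" and eq: "a0 + x = b + b' + of_nat N" for x b b' N
    proof -
      \<comment> \<open>Both sides of \<open>eq\<close> contain \<sigma>^2 twice; cancelling it
        leaves lattice points, whose coordinates can be compared.\<close>
      have "of_int (p0 + P x) + 2 * \<sigma> * of_int (d0 + D x) =
          of_int (P b + P b' + int N) + 2 * \<sigma> * of_int (D b + D b')"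
        using eq supp[of a0] supp[OF nz(1)] supp[OF nz(2)] supp[OF nz(3)] a0 unfolding p0_def d0_def
        by (simp add: algebra_simps) (smt (verit, best) add.commute add.left_commute add_left_imp_eq)
      from irrational_lattice_inj[OF \<sigma>(1) this]
      have PD: "P x = P b + P b' + int N - p0" "D x = D b + D b' - d0" by auto
      have "g x = g b + g b' + int k * int N" unfolding g_def PD by (simp add: algebra_simps)
      hence "int (gr x) = int (gr b + gr b' + k * N)" using nz by (simp add: gr_int)
      thus ?thesis by (simp only: of_nat_eq_iff)
    qed
    show "k > 0" using k p0 by auto
    show "finite {x. f x \<noteq> 0 \<and> gr x \<le> n}" for n
    proof (rule finite_subset)
      define M where "M = int n + 3 * p0"
      show "finite ((\<lambda>(p, d). \<sigma>\<^sup>2 + (of_int p + 2 * \<sigma> * of_int d)) ` ({0..M} \<times> {-M..M}))" by simp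
      show "{x. f x \<noteq> 0 \<and> gr x \<le> n} \<subseteq>
          (\<lambda>(p, d). \<sigma>\<^sup>2 + (of_int p + 2 * \<sigma> * of_int d)) ` ({0..M} \<times> {-M..M})"
      proof
        fix x assume x: "x \<in> {x. f x \<noteq> 0 \<and> gr x \<le> n}"
        have "P x \<le> M" using x g_ge[of x] by (auto simp: M_def gr_def)
        thus "x \<in> (\<lambda>(p, d). \<sigma>\<^sup>2 + (of_int p + 2 * \<sigma> * of_int d)) ` ({0..M} \<times> {-M..M})"
          using x supp[of x] by (intro image_eqI[of _ _ "(P x, D x)"]) auto
      qed
    qed
    show "norm x \<le> B * real (gr x + 1)" if x: "f x \<noteq> 0" for x
    proof -
      have Px: "0 \<le> real_of_int (P x)" "\<bar>real_of_int (D x)\<bar> \<le> real_of_int (P x)"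
        using supp[OF x] by linarith+
      have "norm x \<le> norm (\<sigma>\<^sup>2) + (norm (of_int (P x) :: complex) + norm (2 * \<sigma> * of_int (D x)))"
        using supp[OF x] by (metis norm_triangle_mono norm_triangle_ineq order_refl)
      also have "\<dots> = (norm \<sigma>)\<^sup>2 + (of_int (P x) + 2 * norm \<sigma> * \<bar>of_int (D x)\<bar>)"
        using Px by (simp add: norm_power norm_mult)
      also have "\<dots> \<le> (norm \<sigma>)\<^sup>2 + (of_int (P x) + 2 * norm \<sigma> * of_int (P x))"
        using Px by (intro add_left_mono mult_left_mono) auto
      also have "\<dots> = (norm \<sigma>)\<^sup>2 + (1 + 2 * norm \<sigma>) * of_int (P x)" by (simp add: algebra_simps)
      also have "\<dots> \<le> (norm \<sigma>)\<^sup>2 * (real (gr x) + 1) +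
          (1 + 2 * norm \<sigma>) * ((1 + 3 * of_int p0) * (real (gr x) + 1))"
      proof (intro add_mono mult_left_mono)
        have "real_of_int (P x) \<le> real (gr x) + 3 * of_int p0"
          using g_ge[OF x] gr_real[OF x] by linarith
        also have "\<dots> \<le> (1 + 3 * of_int p0) * (real (gr x) + 1)"
          using p0 by (simp add: algebra_simps)
        finally show "real_of_int (P x) \<le> (1 + 3 * of_int p0) * (real (gr x) + 1)" .
      qed (auto simp: algebra_simps)
      also have "\<dots> \<le> B * real (gr x + 1)"
        using p0 by (simp add: B_def algebra_simps)
      finally show ?thesis .
    qed
    show "\<epsilon> / real (k + 1) * real (gr x) \<le> norm (x - a0) + B" if x: "f x \<noteq> 0" for x
    proof -
      have Px: "\<bar>real_of_int (D x)\<bar> \<le> real_of_int (P x)" "\<bar>real_of_int d0\<bar> \<le> real_of_int p0"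
        using supp[OF x] p0 by linarith+
      have "real (gr x) \<le> real (k + 1) * of_int (P x)"
        using g_le[OF x] gr_real[OF x] by (metis of_int_le_iff of_int_mult of_int_of_nat_eq)
      hence "\<epsilon> / real (k + 1) * real (gr x) \<le> \<epsilon> / real (k + 1) * (real (k + 1) * of_int (P x))"
        using \<epsilon> by (intro mult_left_mono) auto
      also have "\<dots> = \<epsilon> * of_int (P x)" by simp
      \<comment> \<open>Here |Re \<sigma>| < 1/2 enters: the real part of an exponent grows at least
        like \<epsilon> P x.\<close>
      also have "\<dots> \<le> Re (x - a0) + 2 * of_int p0"
      proof -
        have "Re (x - a0) = of_int (P x) - of_int p0 + 2 * (Re \<sigma> * of_int (D x)) - 2 * (Re \<sigma> * of_int d0)"
          using arg_cong[OF conjunct1[OF supp[OF x]], of Re] a0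
            arg_cong[OF conjunct1[OF supp[of a0]], of Re]
          by (simp add: p0_def d0_def)
        moreover have "\<bar>Re \<sigma> * of_int (D x)\<bar> \<le> \<bar>Re \<sigma>\<bar> * of_int (P x)"
          unfolding abs_mult by (intro mult_left_mono Px) auto
        moreover have "\<bar>Re \<sigma> * of_int d0\<bar> \<le> 1 / 2 * of_int p0"
          unfolding abs_mult using \<sigma>(2) by (intro mult_mono Px) auto
        ultimately show ?thesis by (simp add: \<epsilon>_def algebra_simps)
      qed
      also have "\<dots> \<le> norm (x - a0) + B"
        using complex_Re_le_cmod[of "x - a0"] B0 by (simp add: B_def)
      finally show ?thesis .
    qed
    show "B \<ge> 1" using B0 p0 by (simp add: B_def)
    show "\<epsilon> / real (k + 1) > 0" using \<epsilon> by simp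
  qed
  then interpret graded_series f a0 gr k B "\<epsilon> / real (k + 1)" .
  obtain z where z: "0 < z" "z \<le> 1" "weight z summable_on {x. f x \<noteq> 0}"
    using summable_weight[OF sol] .
  show ?thesis
  proof (intro exI conjI)
    \<comment> \<open>The grade is at most (k + 1) P x, so the base z^(k+1) converts powers by grade
      into powers by P x.\<close>
    show "z ^ (k + 1) > 0" "z ^ (k + 1) \<le> 1" using z by (auto intro: power_le_one simp del: power_Suc)
    show "(\<lambda>x. norm (f x) * (z ^ (k + 1)) powr of_int (P x)) summable_on {x. f x \<noteq> 0}"
    proof (rule summable_on_comparison_test[OF z(3)])
      fix x assume "x \<in> {x. f x \<noteq> 0}"
      hence x: "f x \<noteq> 0" by simp
      have "(z ^ (k + 1)) powr of_int (P x) = z powr (real (k + 1) * of_int (P x))"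
        using z(1) by (metis powr_powr powr_realpow)
      also have "\<dots> \<le> z powr real (gr x)"
        using g_le[OF x] gr_real[OF x] z
        by (intro powr_mono') (auto, metis of_int_le_iff of_int_mult of_int_of_nat_eq of_nat_Suc)
      also have "\<dots> = z ^ gr x" using z(1) by (simp add: powr_realpow)
      finally show "norm (f x) * (z ^ (k + 1)) powr of_int (P x) \<le> weight z x"
        unfolding weight_def by (intro mult_left_mono) auto
    qed auto
  qed
qed

section \<open>Absolute convergence in a punctured disc\<close>

text \<open>Summability is carried from exponents to indices along the injective exponent map;
  uniqueness of lattice coordinates identifies P x with m + n.\<close>

lemma ansatz_coeffs_summable:
  assumes "formal_solution N0 \<alpha> (fs_ansatz \<sigma> a)" "\<sigma> \<notin> \<rat>" "\<bar>Re \<sigma>\<bar> < 1/2"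
  shows "\<exists>z>0. z \<le> 1 \<and> (\<lambda>(m, n). norm (a m n) * z powr (m + n)) summable_on index_set"
proof -
  define f where "f = fs_ansatz \<sigma> a"
  have "\<forall>x. \<exists>p d :: int. f x \<noteq> 0 \<longrightarrow> x = \<sigma>\<^sup>2 + (of_int p + 2 * \<sigma> * of_int d) \<and> \<bar>d\<bar> \<le> p"
    unfolding f_def using fs_ansatz_support by metis
  then obtain P D :: "complex \<Rightarrow> int" where
    PD: "f x \<noteq> 0 \<Longrightarrow> x = \<sigma>\<^sup>2 + (of_int (P x) + 2 * \<sigma> * of_int (D x)) \<and> \<bar>D x\<bar> \<le> P x" for x
    by metis
  obtain z where z: "0 < z" "z \<le> 1"
    and sm: "(\<lambda>x. norm (f x) * z powr of_int (P x)) summable_on {x. f x \<noteq> 0}"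
    using graded_summable[OF assms(1)[folded f_def] assms(2,3) PD] by blast
  let ?J = "{(m, n) \<in> index_set. a m n \<noteq> 0}"
  let ?e = "\<lambda>(m, n). \<sigma>\<^sup>2 + expo \<sigma> m n"
  have f_e: "f (\<sigma>\<^sup>2 + expo \<sigma> m n) = a m n" if "(m, n) \<in> index_set" for m n
    using fs_ansatz_expo[OF assms(2) that] by (simp add: f_def)
  have inj: "inj_on ?e ?J"
    using expo_inj[OF assms(2)] by (auto simp: inj_on_def)
  have "(\<lambda>x. norm (f x) * z powr of_int (P x)) summable_on ?e ` ?J"
    by (rule summable_on_subset_banach[OF sm]) (auto simp: f_e)
  hence "((\<lambda>x. norm (f x) * z powr of_int (P x)) \<circ> ?e) summable_on ?J"
    using summable_on_reindex[OF inj] by blast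
  also have "?this \<longleftrightarrow> (\<lambda>(m, n). norm (a m n) * z powr (m + n)) summable_on index_set"
  proof (rule summable_on_cong_neutral)
    fix x assume "x \<in> ?J \<inter> index_set"
    then obtain m n where x: "x = (m, n)" "(m, n) \<in> index_set" "a m n \<noteq> 0" by auto
    obtain p d :: int where pd: "m + n = of_int p" "m - n = of_int d"
      using index_set_ints[OF x(2)] by metis
    have "of_int p + 2 * \<sigma> * of_int d = of_int (P (\<sigma>\<^sup>2 + expo \<sigma> m n)) +
        2 * \<sigma> * of_int (D (\<sigma>\<^sup>2 + expo \<sigma> m n))"
      using PD[of "\<sigma>\<^sup>2 + expo \<sigma> m n"] f_e[OF x(2)] x(3) pd unfolding expo_eq
      by (metis add_left_imp_eq of_real_of_int_eq)
    from irrational_lattice_inj[OF assms(2) this]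
    show "((\<lambda>x. norm (f x) * z powr of_int (P x)) \<circ> ?e) x =
        (case x of (m, n) \<Rightarrow> norm (a m n) * z powr (m + n))"
      using x pd f_e[OF x(2)] by simp
  qed auto
  finally show ?thesis using z by blast
qed

theorem theorem2:
  fixes N\<^sub>0 :: nat
    and \<alpha> :: "nat \<Rightarrow> nat \<Rightarrow> nat \<Rightarrow> complex"
    and \<sigma> :: complex
    and a :: "real \<Rightarrow> real \<Rightarrow> complex"
  assumes "N\<^sub>0 > 0"
    and "formal_solution N\<^sub>0 \<alpha> (fs_ansatz \<sigma> a)"
    and "\<sigma> \<notin> \<rat>"
    and "\<bar>Re \<sigma>\<bar> < 1/2"
  shows "\<forall>\<theta>. \<exists>D. open D \<and> connected D \<and> D \<subseteq> UNIV - {0} \<and>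
           (\<exists>r>0. ball 0 r - {0} \<subseteq> D) \<and>
           (\<forall>t\<in>D. ansatz_converges_at \<sigma> a \<theta> t)"
proof
  fix \<theta> :: real
  obtain z where z: "0 < z" "z \<le> 1"
    and sm: "(\<lambda>(m, n). norm (a m n) * z powr (m + n)) summable_on index_set"
    using ansatz_coeffs_summable[OF assms(2-4)] by blast
  define \<epsilon> where "\<epsilon> = 1 - 2 * \<bar>Re \<sigma>\<bar>"
  have \<epsilon>: "\<epsilon> > 0" using assms(4) by (simp add: \<epsilon>_def)
  define A where "A = \<bar>\<theta>\<bar> + pi"
  \<comment> \<open>For |t| < r this gives \<epsilon> ln |t| + 2 |Im \<sigma>| A \<le> ln z, where A
    bounds the argument of t on the chosen branch.\<close>
  define r where "r = exp ((ln z - 2 * \<bar>Im \<sigma>\<bar> * A) / \<epsilon>)"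
  have lnz: "ln z \<le> 0" using z by simp
  have A: "A \<ge> 0" by (simp add: A_def)
  have conv: "ansatz_converges_at \<sigma> a \<theta> t" if t: "t \<in> ball 0 r - {0}" for t
  proof -
    define u where "u = Ln (t * cis (- \<theta>)) + \<i> * of_real \<theta>"
    have t0: "t \<noteq> 0" "norm t < r" using t by auto
    have Re_u: "Re u = ln (norm t)" using t0 by (simp add: u_def norm_mult)
    have Im_u: "\<bar>Im u\<bar> \<le> A"
      using mpi_less_Im_Ln[of "t * cis (- \<theta>)"] Im_Ln_le_pi[of "t * cis (- \<theta>)"] t0
      by (simp add: u_def A_def)
    have "Re u < ln r"
      unfolding Re_u using t0 by (subst ln_less_cancel_iff) (auto simp: r_def)
    hence "\<epsilon> * Re u \<le> ln z - 2 * \<bar>Im \<sigma>\<bar> * A" using \<epsilon> by (simp add: r_def field_simps)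
    moreover have "2 * \<bar>Im \<sigma>\<bar> * A \<ge> 0" using A by simp
    ultimately have u1: "\<epsilon> * Re u + 2 * \<bar>Im \<sigma>\<bar> * A \<le> ln z" and "\<epsilon> * Re u \<le> 0"
      using lnz by linarith+
    \<comment> \<open>The sign of ln |t| is needed below, where an inequality is multiplied by
      it.\<close>
    hence u0: "Re u \<le> 0" using \<epsilon> by (simp add: mult_le_0_iff)
    have bound: "norm (branch_power \<theta> t (expo \<sigma> m n)) \<le> z powr (m + n)"
      if mn: "(m, n) \<in> index_set" for m n
    proof -
      obtain p d :: int where pd: "m + n = of_int p" "m - n = of_int d" "\<bar>d\<bar> \<le> p"
        using index_set_ints[OF mn] .
      have dp: "\<bar>m - n\<bar> \<le> m + n" using pd by linarith
      have "\<epsilon> * (m + n) \<le> (m + n) + 2 * (Re \<sigma> * (m - n))"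
      proof -
        have "\<bar>Re \<sigma> * (m - n)\<bar> \<le> \<bar>Re \<sigma>\<bar> * (m + n)"
          unfolding abs_mult by (intro mult_left_mono dp) auto
        thus ?thesis by (simp add: \<epsilon>_def algebra_simps)
      qed
      from mult_right_mono_neg[OF this u0]
      have 1: "((m + n) + 2 * (Re \<sigma> * (m - n))) * Re u \<le> \<epsilon> * (m + n) * Re u" .
      have "\<bar>Im \<sigma> * (m - n) * Im u\<bar> \<le> \<bar>Im \<sigma>\<bar> * (m + n) * A"
        unfolding abs_mult by (intro mult_mono dp Im_u) (use dp in auto)
      hence 2: "- (2 * (Im \<sigma> * (m - n)) * Im u) \<le> 2 * \<bar>Im \<sigma>\<bar> * A * (m + n)"
        by (simp add: algebra_simps)
      \<comment> \<open>The modulus of the power is the exponential of this real part; |m - n| \<le>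
        m + n bounds both contributions of \<sigma>.\<close>
      have "Re (expo \<sigma> m n * u) = ((m + n) + 2 * (Re \<sigma> * (m - n))) * Re u - 2 * (Im \<sigma> * (m - n)) * Im u"
        unfolding expo_eq by (simp add: algebra_simps)
      also have "\<dots> \<le> (\<epsilon> * Re u + 2 * \<bar>Im \<sigma>\<bar> * A) * (m + n)"
        using 1 2 by (simp add: algebra_simps)
      also have "\<dots> \<le> ln z * (m + n)" using u1 dp by (intro mult_right_mono) auto
      finally show ?thesis using z(1) by (simp add: branch_power_def powr_def mult.commute flip: u_def)
    qed
    have "(\<lambda>(m, n). a m n * branch_power \<theta> t (expo \<sigma> m n)) summable_on index_set"
    proof (rule abs_summable_summable, rule summable_on_comparison_test[OF sm])
      fix x assume "x \<in> index_set"
      thus "norm (case x of (m, n) \<Rightarrow> a m n * branch_power \<theta> t (expo \<sigma> m n)) \<le>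
          (case x of (m, n) \<Rightarrow> norm (a m n) * z powr (m + n))"
        using bound by (auto simp: norm_mult split: prod.split intro!: mult_left_mono)
    qed auto
    from summable_on_cmult_right[OF this, of "branch_power \<theta> t (\<sigma>\<^sup>2)"]
    show ?thesis by (simp add: ansatz_converges_at_def case_prod_unfold)
  qed
  have "open (ball (0 :: complex) r - {0})" by (simp add: open_delete)
  moreover have "connected (ball (0 :: complex) r - {0})"
    by (rule connected_punctured_ball) simp
  moreover have "r > 0" by (simp add: r_def)
  ultimately show "\<exists>D. open D \<and> connected D \<and> D \<subseteq> UNIV - {0} \<and>
           (\<exists>r>0. ball 0 r - {0} \<subseteq> D) \<and> (\<forall>t\<in>D. ansatz_converges_at \<sigma> a \<theta> t)"
    using conv by (intro exI[of _ "ball 0 r - {0}"]) blast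
qed

end
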